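(* Let $k\ge1$ be an integer and let $x_0,x_1,\ldots,x_{k+1}\in\mathbb{Q}$ be pairwise distinct. Let $W_{k+1}^k\subset\mathbb{P}^{k+1}$, with homogeneous coordinates $(Y_0,\ldots,Y_{k+1})$, be the quadric hypersurface $$\det\begin{pmatrix}1&1&\cdots&1&1\\ x_0&x_1&\cdots&x_k&x_{k+1}\\ \vdots&\vdots&&\vdots&\vdots\\ x_0^k&x_1^k&\cdots&x_k^k&x_{k+1}^k\\ Y_0^2&Y_1^2&\cdots&Y_k^2&Y_{k+1}^2\end{pmatrix}=0.$$ Then $W_{k+1}^k$ is rational.
   Context: A variety is called rational if it is $\mathbb{Q}$-birational to $\mathbb{P}^m$ for some $m\ge1$. *)

theory Defs
  imports "HOL-Library.Poly_Mapping" Complex_Main "Jordan_Normal_Form.Determinant"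
begin

text \<open>
  Varieties over \<open>\<rat>\<close> are treated classically: a variety is the set of its complex points, while
  all equations and all rational maps have coefficients in \<open>\<rat>\<close>. Rational points alone
  would not suffice, as a \<open>\<rat>\<close>-variety may have very few of them.
\<close>

text \<open>Polynomials over \<open>\<rat>\<close> in the variables \<open>Y\<^sub>0, Y\<^sub>1, \<dots>\<close>: a monomial is a finitely supported
  exponent function, a polynomial a finitely supported coefficient function on monomials.\<close>

type_synonym qpoly = "(nat \<Rightarrow>\<^sub>0 nat) \<Rightarrow>\<^sub>0 rat"

definition Cnst :: "rat \<Rightarrow> qpoly" where
  "Cnst c = Poly_Mapping.single 0 c"

definition Y :: "nat \<Rightarrow> qpoly" where
  "Y j = Poly_Mapping.single (Poly_Mapping.single j 1) 1"

definition peval :: "qpoly \<Rightarrow> (nat \<Rightarrow> complex) \<Rightarrow> complex" where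
  "peval p y =
     (\<Sum>m\<in>Poly_Mapping.keys p. of_rat (Poly_Mapping.lookup p m) *
        (\<Prod>i\<in>Poly_Mapping.keys m. y i ^ Poly_Mapping.lookup m i))"

text \<open>\<open>forms n d\<close>: homogeneous of degree \<open>d\<close> in \<open>Y\<^sub>0, \<dots>, Y\<^sub>n\<close> (including the zero polynomial).\<close>

definition forms :: "nat \<Rightarrow> nat \<Rightarrow> qpoly set" where
  "forms n d = {p. \<forall>m\<in>Poly_Mapping.keys p.
     Poly_Mapping.keys m \<subseteq> {..n} \<and> (\<Sum>i\<in>Poly_Mapping.keys m. Poly_Mapping.lookup m i) = d}"

text \<open>A point of projective space is the class \<open>hclass y\<close> of its vectors of homogeneous
  coordinates; a vector in \<open>\<complex>\<^bsup>n+1\<^esup>\<close> is a function on \<open>nat\<close> vanishing beyond \<open>n\<close>.\<close>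

definition hclass :: "(nat \<Rightarrow> complex) \<Rightarrow> (nat \<Rightarrow> complex) set" where
  "hclass y = {\<lambda>i. c * y i | c. c \<noteq> 0}"

definition proj_space :: "nat \<Rightarrow> (nat \<Rightarrow> complex) set set" where
  "proj_space n = hclass ` {y. (\<forall>i>n. y i = 0) \<and> (\<exists>i\<le>n. y i \<noteq> 0)}"

definition zero_locus :: "nat \<Rightarrow> qpoly set \<Rightarrow> (nat \<Rightarrow> complex) set set" where
  "zero_locus n S = {P \<in> proj_space n. \<forall>y\<in>P. \<forall>p\<in>S. peval p y = 0}"

definition zariski_closed :: "nat \<Rightarrow> (nat \<Rightarrow> complex) set set \<Rightarrow> bool" where
  "zariski_closed n V \<longleftrightarrow> (\<exists>S \<subseteq> (\<Union>d. forms n d). V = zero_locus n S)"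

definition proj_variety :: "nat \<Rightarrow> (nat \<Rightarrow> complex) set set \<Rightarrow> bool" where
  "proj_variety n V \<longleftrightarrow> zariski_closed n V \<and> V \<noteq> {} \<and>
     (\<forall>A B. zariski_closed n A \<longrightarrow> zariski_closed n B \<longrightarrow> V \<subseteq> A \<union> B \<longrightarrow> V \<subseteq> A \<or> V \<subseteq> B)"

text \<open>A rational map to \<open>m\<close>-dimensional projective space is represented by forms
  \<open>F 0, \<dots>, F m\<close> of a common degree. The representative is defined where they do not all vanish,
  that is, where \<open>tuple_eval m F y \<noteq> 0\<close>.\<close>

definition tuple_eval :: "nat \<Rightarrow> (nat \<Rightarrow> qpoly) \<Rightarrow> (nat \<Rightarrow> complex) \<Rightarrow> nat \<Rightarrow> complex" where
  "tuple_eval m F y = (\<lambda>j. if j \<le> m then peval (F j) y else 0)"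

definition rat_image ::
  "(nat \<Rightarrow> complex) set set \<Rightarrow> nat \<Rightarrow> (nat \<Rightarrow> qpoly) \<Rightarrow> (nat \<Rightarrow> complex) set set" where
  "rat_image V m F = {hclass (tuple_eval m F y) | y. hclass y \<in> V \<and> tuple_eval m F y \<noteq> (\<lambda>_. 0)}"

definition rational_map :: "nat \<Rightarrow> (nat \<Rightarrow> complex) set set \<Rightarrow>
    nat \<Rightarrow> (nat \<Rightarrow> complex) set set \<Rightarrow> (nat \<Rightarrow> qpoly) \<Rightarrow> bool" where
  "rational_map n V m W F \<longleftrightarrow>
     (\<exists>d. \<forall>j\<le>m. F j \<in> forms n d) \<and> rat_image V m F \<noteq> {} \<and> rat_image V m F \<subseteq> W"

definition dominant :: "(nat \<Rightarrow> complex) set set \<Rightarrow>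
    nat \<Rightarrow> (nat \<Rightarrow> complex) set set \<Rightarrow> (nat \<Rightarrow> qpoly) \<Rightarrow> bool" where
  "dominant V m W F \<longleftrightarrow> (\<forall>Z. zariski_closed m Z \<longrightarrow> rat_image V m F \<subseteq> Z \<longrightarrow> W \<subseteq> Z)"

text \<open>\<open>comp_is_id V n m F G\<close>: \<open>G \<circ> F\<close> is the identity of \<open>V\<close> as a rational map, where \<open>V\<close> lies in
  \<open>n\<close>-dimensional and the target of \<open>F\<close> in \<open>m\<close>-dimensional projective space. For dominant \<open>F\<close>,
  the set where the composite of the two representatives is defined is nonempty.\<close>

definition comp_is_id :: "(nat \<Rightarrow> complex) set set \<Rightarrow> nat \<Rightarrow> nat \<Rightarrow>
    (nat \<Rightarrow> qpoly) \<Rightarrow> (nat \<Rightarrow> qpoly) \<Rightarrow> bool" where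
  "comp_is_id V n m F G \<longleftrightarrow>
     (\<forall>y. hclass y \<in> V \<longrightarrow> tuple_eval m F y \<noteq> (\<lambda>_. 0) \<longrightarrow>
        tuple_eval n G (tuple_eval m F y) \<noteq> (\<lambda>_. 0) \<longrightarrow>
        hclass (tuple_eval n G (tuple_eval m F y)) = hclass y)"

definition Q_birational :: "nat \<Rightarrow> (nat \<Rightarrow> complex) set set \<Rightarrow>
    nat \<Rightarrow> (nat \<Rightarrow> complex) set set \<Rightarrow> bool" where
  "Q_birational n V m W \<longleftrightarrow> (\<exists>F G.
     rational_map n V m W F \<and> dominant V m W F \<and>
     rational_map m W n V G \<and> dominant W n V G \<and>
     comp_is_id V n m F G \<and> comp_is_id W m n G F)"

definition rational_variety :: "nat \<Rightarrow> (nat \<Rightarrow> complex) set set \<Rightarrow> bool" where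
  "rational_variety n V \<longleftrightarrow> proj_variety n V \<and> (\<exists>m\<ge>1. Q_birational n V m (proj_space m))"

definition W_poly :: "nat \<Rightarrow> (nat \<Rightarrow> rat) \<Rightarrow> qpoly" where
  "W_poly k x = det (mat (k + 2) (k + 2) (\<lambda>(i, j). if i \<le> k then Cnst (x j ^ i) else Y j ^ 2))"

definition W_quadric :: "nat \<Rightarrow> (nat \<Rightarrow> rat) \<Rightarrow> (nat \<Rightarrow> complex) set set" where
  "W_quadric k x = zero_locus (k + 1) {W_poly k x}"

end

theory Submission
  imports Defs
begin

text \<open>
  Expanding the determinant along its last row gives the diagonal form \<open>\<Sum>\<^sub>j a\<^sub>j Y\<^sub>j\<^sup>2\<close>, whose
  coefficients are Vandermonde minors and hence nonzero. They sum to \<open>0\<close>, because the determinant has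
  two equal rows at \<open>(1, \<dots>, 1)\<close>. Projection from this rational point is therefore birational to
  projective space of dimension \<open>k\<close>. Irreducibility follows from the dominance of the inverse
  parametrization: two forms that do not vanish on the quadric pull back to nonzero polynomials,
  which have a common nonzero on a line.
\<close>

section \<open>Evaluating polynomials\<close>

definition mono_eval :: "(nat \<Rightarrow>\<^sub>0 nat) \<Rightarrow> (nat \<Rightarrow> complex) \<Rightarrow> complex" where
  "mono_eval m y = (\<Prod>i\<in>Poly_Mapping.keys m. y i ^ Poly_Mapping.lookup m i)"

text \<open>Monomials with different supports become comparable over a common index set, where the
  added factors have exponent 0.\<close>

lemma mono_eval_superset:
  assumes "finite I" "Poly_Mapping.keys m \<subseteq> I"
  shows "mono_eval m y = (\<Prod>i\<in>I. y i ^ Poly_Mapping.lookup m i)"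
  unfolding mono_eval_def
  by (rule prod.mono_neutral_left) (use assms in \<open>auto simp: in_keys_iff\<close>)

lemma mono_eval_add: "mono_eval (m + m') y = mono_eval m y * mono_eval m' y"
proof -
  let ?I = "Poly_Mapping.keys m \<union> Poly_Mapping.keys m'"
  have "mono_eval (m + m') y = (\<Prod>i\<in>?I. y i ^ Poly_Mapping.lookup (m + m') i)"
    by (rule mono_eval_superset) (auto simp: keys_add)
  also have "\<dots> = (\<Prod>i\<in>?I. y i ^ Poly_Mapping.lookup m i) * (\<Prod>i\<in>?I. y i ^ Poly_Mapping.lookup m' i)"
    by (simp add: lookup_add power_add prod.distrib)
  also have "\<dots> = mono_eval m y * mono_eval m' y"
    by (simp add: mono_eval_superset[of ?I])
  finally show ?thesis .
qed

lemma peval_mono: "peval p y = (\<Sum>m\<in>Poly_Mapping.keys p. of_rat (Poly_Mapping.lookup p m) * mono_eval m y)"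
  by (simp add: peval_def mono_eval_def)

lemma peval_superset:
  assumes "finite M" "Poly_Mapping.keys p \<subseteq> M"
  shows "peval p y = (\<Sum>m\<in>M. of_rat (Poly_Mapping.lookup p m) * mono_eval m y)"
  unfolding peval_mono
  by (rule sum.mono_neutral_left) (use assms in \<open>auto simp: in_keys_iff\<close>)

lemma peval_single: "peval (Poly_Mapping.single m c) y = of_rat c * mono_eval m y"
  by (subst peval_superset[of "{m}"]) (auto simp: lookup_single)

lemma peval_add: "peval (p + q) y = peval p y + peval q y"
proof -
  let ?M = "Poly_Mapping.keys p \<union> Poly_Mapping.keys q"
  have "peval (p + q) y = (\<Sum>m\<in>?M. of_rat (Poly_Mapping.lookup (p + q) m) * mono_eval m y)"
    by (rule peval_superset) (auto simp: keys_add)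
  also have "\<dots> = peval p y + peval q y"
    by (simp add: peval_superset[of ?M] lookup_add of_rat_add algebra_simps sum.distrib)
  finally show ?thesis .
qed

lemma peval_zero [simp]: "peval 0 y = 0"
  by (simp add: peval_def)

lemma peval_uminus: "peval (- p) y = - peval p y"
  using peval_add[of p "- p" y] by (simp add: eq_neg_iff_add_eq_0 add.commute)

lemma peval_diff: "peval (p - q) y = peval p y - peval q y"
  using peval_add[of p "- q" y] by (simp add: peval_uminus)

lemma peval_sum: "peval (\<Sum>i\<in>I. f i) y = (\<Sum>i\<in>I. peval (f i) y)"
  by (induction I rule: infinite_finite_induct) (auto simp: peval_add)

lemma qpoly_expansion:
  fixes p :: qpoly
  shows "p = (\<Sum>m\<in>Poly_Mapping.keys p. Poly_Mapping.single m (Poly_Mapping.lookup p m))"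
  by (rule poly_mapping_eqI)
    (auto simp: lookup_sum lookup_single when_def in_keys_iff)

lemma peval_mult: "peval (p * q) y = peval p y * peval q y"
proof -
  have "peval (p * q) y = peval ((\<Sum>m\<in>Poly_Mapping.keys p. Poly_Mapping.single m (Poly_Mapping.lookup p m)) *
      (\<Sum>m\<in>Poly_Mapping.keys q. Poly_Mapping.single m (Poly_Mapping.lookup q m))) y"
    using qpoly_expansion[of p] qpoly_expansion[of q] by simp
  also have "\<dots> = peval p y * peval q y"
    by (simp add: sum_product peval_sum mult_single peval_single mono_eval_add of_rat_mult mult_ac
        peval_mono[of p] peval_mono[of q])
  finally show ?thesis .
qed

lemma peval_Cnst [simp]: "peval (Cnst c) y = of_rat c"
  by (simp add: Cnst_def peval_single mono_eval_def)

lemma peval_Y [simp]: "peval (Y j) y = y j"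
  by (simp add: Y_def peval_single mono_eval_def)

lemma peval_Y_square [simp]: "peval (Y j ^ 2) y = y j ^ 2"
  by (simp only: power2_eq_square peval_mult peval_Y)

lemma comm_ring_hom_Cnst: "comm_ring_hom Cnst"
  by unfold_locales (auto simp: Cnst_def single_add mult_single)

text \<open>Substituting one-variable polynomials for the coordinates yields a one-variable
  polynomial. Hence on such a curve an equation either holds identically or has only finitely many
  solutions.\<close>

lemma peval_polynomial_curve:
  fixes c :: "nat \<Rightarrow> complex poly"
  shows "\<exists>P. \<forall>t. peval p (\<lambda>i. poly (c i) t) = poly P t"
proof (intro exI allI)
  show "peval p (\<lambda>i. poly (c i) t) = poly (\<Sum>m\<in>Poly_Mapping.keys p. [:of_rat (Poly_Mapping.lookup p m):] *
      (\<Prod>i\<in>Poly_Mapping.keys m. c i ^ Poly_Mapping.lookup m i)) t" for t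
    by (simp add: peval_def poly_sum poly_prod)
qed


section \<open>Forms\<close>

lemma forms_add: "p \<in> forms n d \<Longrightarrow> q \<in> forms n d \<Longrightarrow> p + q \<in> forms n d"
  using keys_add[of p q] unfolding forms_def by blast

lemma forms_uminus: "p \<in> forms n d \<Longrightarrow> - p \<in> forms n d"
  by (simp add: forms_def keys_minus)

lemma forms_diff: "p \<in> forms n d \<Longrightarrow> q \<in> forms n d \<Longrightarrow> p - q \<in> forms n d"
  using forms_add[of p n d "- q"] by (simp add: forms_uminus)

lemma forms_zero: "0 \<in> forms n d"
  by (simp add: forms_def)

lemma forms_sum: "(\<And>i. i \<in> I \<Longrightarrow> f i \<in> forms n d) \<Longrightarrow> (\<Sum>i\<in>I. f i) \<in> forms n d"
  by (induction I rule: infinite_finite_induct) (auto simp: forms_add forms_zero)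

lemma degree_monomial_add:
  fixes m m' :: "nat \<Rightarrow>\<^sub>0 nat"
  shows "(\<Sum>i\<in>Poly_Mapping.keys (m + m'). Poly_Mapping.lookup (m + m') i) =
    (\<Sum>i\<in>Poly_Mapping.keys m. Poly_Mapping.lookup m i) + (\<Sum>i\<in>Poly_Mapping.keys m'. Poly_Mapping.lookup m' i)"
  by (rule setsum_keys_plus_distrib) auto

lemma forms_mult:
  assumes "p \<in> forms n d" "q \<in> forms n e"
  shows "p * q \<in> forms n (d + e)"
  unfolding forms_def
proof (intro CollectI ballI)
  fix m assume "m \<in> Poly_Mapping.keys (p * q)"
  then obtain a b where m: "m = a + b" and ab: "a \<in> Poly_Mapping.keys p" "b \<in> Poly_Mapping.keys q"
    using keys_mult[of p q] by blast
  then show "Poly_Mapping.keys m \<subseteq> {..n} \<and> (\<Sum>i\<in>Poly_Mapping.keys m. Poly_Mapping.lookup m i) = d + e"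
    using assms keys_add[of a b] unfolding m degree_monomial_add forms_def by fastforce
qed

lemma forms_Cnst: "Cnst c \<in> forms n 0"
  by (simp add: forms_def Cnst_def)

lemma forms_Y: "j \<le> n \<Longrightarrow> Y j \<in> forms n 1"
  by (simp add: forms_def Y_def)

lemma forms_Cnst_mult: "p \<in> forms n d \<Longrightarrow> Cnst c * p \<in> forms n d"
  using forms_mult[OF forms_Cnst] by fastforce

lemma forms_Y_square: "j \<le> n \<Longrightarrow> Y j ^ 2 \<in> forms n 2"
  using forms_mult[OF forms_Y forms_Y, of j n j] by (simp add: power2_eq_square numeral_2_eq_2)

lemma peval_scale:
  assumes "p \<in> forms n d"
  shows "peval p (\<lambda>i. c * y i) = c ^ d * peval p y"
proof -
  have "mono_eval m (\<lambda>i. c * y i) = c ^ d * mono_eval m y" if "m \<in> Poly_Mapping.keys p" for m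
    using assms that unfolding mono_eval_def forms_def
    by (auto simp: power_mult_distrib prod.distrib power_sum)
  then show ?thesis
    by (simp add: peval_mono sum_distrib_left mult.left_commute)
qed


section \<open>Projective closed sets\<close>

lemma mem_hclass: "y \<in> hclass y"
  unfolding hclass_def by (rule CollectI, rule exI[of _ 1]) auto

lemma hclass_scale:
  assumes "c \<noteq> 0"
  shows "hclass (\<lambda>i. c * y i) = hclass y"
proof
  show "hclass (\<lambda>i. c * y i) \<subseteq> hclass y"
  proof
    fix z assume "z \<in> hclass (\<lambda>i. c * y i)"
    then obtain d where "d \<noteq> 0" "z = (\<lambda>i. d * (c * y i))" by (auto simp: hclass_def)
    then show "z \<in> hclass y"
      using assms unfolding hclass_def by (intro CollectI exI[of _ "d * c"]) (auto simp: mult.assoc)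
  qed
  show "hclass y \<subseteq> hclass (\<lambda>i. c * y i)"
  proof
    fix z assume "z \<in> hclass y"
    then obtain d where "d \<noteq> 0" "z = (\<lambda>i. d * y i)" by (auto simp: hclass_def)
    then show "z \<in> hclass (\<lambda>i. c * y i)"
      using assms unfolding hclass_def by (intro CollectI exI[of _ "d / c"]) auto
  qed
qed

lemma hclass_eq_iff: "hclass y = hclass z \<longleftrightarrow> (\<exists>c. c \<noteq> 0 \<and> y = (\<lambda>i. c * z i))"
proof
  assume "hclass y = hclass z"
  then have "y \<in> hclass z" using mem_hclass by metis
  then show "\<exists>c. c \<noteq> 0 \<and> y = (\<lambda>i. c * z i)" by (auto simp: hclass_def)
qed (auto simp: hclass_scale)

lemma hclass_mem_proj_space:
  "hclass y \<in> proj_space n \<longleftrightarrow> (\<forall>i>n. y i = 0) \<and> y \<noteq> (\<lambda>_. 0)"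
proof -
  have "(\<forall>i>n. y i = 0) \<and> y \<noteq> (\<lambda>_. 0) \<longleftrightarrow> (\<forall>i>n. y i = 0) \<and> (\<exists>i\<le>n. y i \<noteq> 0)" for y :: "nat \<Rightarrow> complex"
    by (auto simp: fun_eq_iff) (meson not_less)
  moreover have "hclass y \<in> proj_space n \<longleftrightarrow> (\<forall>i>n. y i = 0) \<and> (\<exists>i\<le>n. y i \<noteq> 0)"
  proof
    assume "hclass y \<in> proj_space n"
    then obtain z c i where "\<forall>i>n. z i = 0" "i \<le> n" "z i \<noteq> 0" "c \<noteq> 0" "y = (\<lambda>i. c * z i)"
      by (auto simp: proj_space_def hclass_eq_iff)
    then show "(\<forall>i>n. y i = 0) \<and> (\<exists>i\<le>n. y i \<noteq> 0)"
      by auto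
  qed (auto simp: proj_space_def)
  ultimately show ?thesis by simp
qed

lemma proj_space_cases:
  assumes "P \<in> proj_space n"
  obtains y where "P = hclass y"
  using assms by (auto simp: proj_space_def)

text \<open>By homogeneity a form vanishing at one representative vanishes at all of them, so
  membership may be tested on \<open>y\<close> alone.\<close>

lemma hclass_mem_zero_locus:
  assumes "S \<subseteq> (\<Union>d. forms n d)"
  shows "hclass y \<in> zero_locus n S \<longleftrightarrow> hclass y \<in> proj_space n \<and> (\<forall>p\<in>S. peval p y = 0)"
proof -
  have "peval p z = 0" if p: "p \<in> S" and z: "z \<in> hclass y" and "peval p y = 0" for p z
  proof -
    obtain d where "p \<in> forms n d" using p assms by blast
    moreover obtain c where "z = (\<lambda>i. c * y i)" using z by (auto simp: hclass_def)
    ultimately show ?thesis using \<open>peval p y = 0\<close> by (simp add: peval_scale)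
  qed
  then show ?thesis
    unfolding zero_locus_def using mem_hclass[of y] by auto
qed

lemma zariski_closed_zero_locus:
  "p \<in> forms n d \<Longrightarrow> zariski_closed n (zero_locus n {p})"
  unfolding zariski_closed_def by (intro exI[of _ "{p}"]) auto

text \<open>Some equation of \<open>Z\<close> fails at the parameter \<open>s\<close>. Restricted to
  the curve it is a nonzero polynomial, and its roots include every parameter whose point lies in
  \<open>Z\<close>.\<close>

lemma finite_polynomial_curve_mem:
  fixes c :: "nat \<Rightarrow> complex poly"
  assumes "zariski_closed n Z"
    and "hclass (\<lambda>i. poly (c i) s) \<in> proj_space n" "hclass (\<lambda>i. poly (c i) s) \<notin> Z"
  shows "finite {t. hclass (\<lambda>i. poly (c i) t) \<in> Z}"
proof -
  obtain S where S: "S \<subseteq> (\<Union>d. forms n d)" and Z: "Z = zero_locus n S"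
    using assms(1) by (auto simp: zariski_closed_def)
  obtain p where p: "p \<in> S" "peval p (\<lambda>i. poly (c i) s) \<noteq> 0"
    using assms(2,3) by (auto simp: Z hclass_mem_zero_locus[OF S])
  obtain P where P: "\<And>t. peval p (\<lambda>i. poly (c i) t) = poly P t"
    using peval_polynomial_curve[of p c] by blast
  have "P \<noteq> 0" using p P by auto
  moreover have "{t. hclass (\<lambda>i. poly (c i) t) \<in> Z} \<subseteq> {t. poly P t = 0}"
    using p(1) by (auto simp: Z hclass_mem_zero_locus[OF S] simp flip: P)
  ultimately show ?thesis
    using poly_roots_finite finite_subset by blast
qed

text \<open>Otherwise finitely many parameters would exhaust the infinite field of complex numbers.
  Dominance is proved this way: a point is deformed along a curve into the image.\<close>

lemma zariski_closed_polynomial_curve: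
  fixes c :: "nat \<Rightarrow> complex poly"
  assumes "zariski_closed n Z" and "finite E"
    and "\<And>t. t \<notin> E \<Longrightarrow> hclass (\<lambda>i. poly (c i) t) \<in> Z"
    and "hclass (\<lambda>i. poly (c i) s) \<in> proj_space n"
  shows "hclass (\<lambda>i. poly (c i) s) \<in> Z"
proof (rule ccontr)
  assume "hclass (\<lambda>i. poly (c i) s) \<notin> Z"
  with assms have "finite (E \<union> {t. hclass (\<lambda>i. poly (c i) t) \<in> Z})"
    by (simp add: finite_polynomial_curve_mem)
  moreover have "E \<union> {t. hclass (\<lambda>i. poly (c i) t) \<in> Z} = UNIV"
    using assms(3) by auto
  ultimately show False
    using infinite_UNIV_char_0[where 'a = complex] by simp
qed


section \<open>Stereographic projection\<close>

text \<open>Coefficient sum 0 says that \<open>e = (1, ..., 1)\<close> lies on the quadric; it is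
  the centre of projection. From \<open>k \<ge> 1\<close> there are at least three
  coordinates.\<close>

locale diagonal_quadric =
  fixes k :: nat and a :: "nat \<Rightarrow> rat"
  assumes k: "k \<ge> 1"
    and a_neq_0: "\<And>j. j \<le> Suc k \<Longrightarrow> a j \<noteq> 0"
    and a_sum: "(\<Sum>j\<le>Suc k. a j) = 0"
begin

definition bil :: "(nat \<Rightarrow> complex) \<Rightarrow> (nat \<Rightarrow> complex) \<Rightarrow> complex" where
  "bil y z = (\<Sum>j\<le>Suc k. of_rat (a j) * y j * z j)"

text \<open>The polar form of the quadric at the rational point \<open>(1, \<dots>, 1)\<close>.\<close>

definition lin :: "(nat \<Rightarrow> complex) \<Rightarrow> complex" where
  "lin y = (\<Sum>j\<le>Suc k. of_rat (a j) * y j)"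

definition quadric_poly :: qpoly where
  "quadric_poly = (\<Sum>j\<le>Suc k. Cnst (a j) * Y j ^ 2)"

definition quadric :: "(nat \<Rightarrow> complex) set set" where
  "quadric = zero_locus (Suc k) {quadric_poly}"

text \<open>Linear projection from \<open>e\<close> onto the hyperplane where the last coordinate
  vanishes: \<open>Y (Suc k)\<close> times \<open>e\<close> is subtracted.\<close>

definition proj :: "nat \<Rightarrow> qpoly" where
  "proj j = Y j - Y (Suc k)"

text \<open>The line through \<open>e = (1, \<dots>, 1)\<close> and \<open>u\<close> meets the quadric again in
  \<open>bil u u e - 2 lin u u\<close>; here \<open>u\<close> ranges over the hyperplane \<open>Y\<^bsub>k+1\<^esub> = 0\<close>.\<close>

definition param :: "nat \<Rightarrow> qpoly" where
  "param j = (\<Sum>i\<le>k. Cnst (a i) * Y i ^ 2)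
     - (if j \<le> k then Cnst 2 * ((\<Sum>i\<le>k. Cnst (a i) * Y i) * Y j) else 0)"

section \<open>Algebra of the polar form\<close>

lemma of_rat_a_neq_0: "j \<le> Suc k \<Longrightarrow> complex_of_rat (a j) \<noteq> 0"
  using a_neq_0 by simp

lemma of_rat_a_sum: "(\<Sum>j\<le>Suc k. complex_of_rat (a j)) = 0"
  using a_sum by (metis of_rat_0 of_rat_sum)

lemma bil_commute: "bil y z = bil z y"
  by (simp add: bil_def mult_ac)

lemma bil_add_left: "bil (\<lambda>i. x i + y i) z = bil x z + bil y z"
  by (simp add: bil_def algebra_simps sum.distrib)

lemma bil_scale_left: "bil (\<lambda>i. c * y i) z = c * bil y z"
  by (simp add: bil_def algebra_simps sum_distrib_left)

lemma bil_diff_left: "bil (\<lambda>i. x i - y i) z = bil x z - bil y z"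
  by (simp add: bil_def algebra_simps sum_subtractf)

lemma bil_add_right: "bil z (\<lambda>i. x i + y i) = bil z x + bil z y"
  by (simp add: bil_def algebra_simps sum.distrib)

lemma bil_scale_right: "bil z (\<lambda>i. c * y i) = c * bil z y"
  by (simp add: bil_def algebra_simps sum_distrib_left)

lemma bil_diff_right: "bil z (\<lambda>i. x i - y i) = bil z x - bil z y"
  by (simp add: bil_def algebra_simps sum_subtractf)

lemmas bil_linear = bil_add_left bil_scale_left bil_diff_left
  bil_add_right bil_scale_right bil_diff_right

lemma lin_zero [simp]: "lin (\<lambda>_. 0) = 0"
  by (simp add: lin_def)

lemma lin_add: "lin (\<lambda>i. x i + y i) = lin x + lin y"
  by (simp add: lin_def algebra_simps sum.distrib)

lemma lin_scale: "lin (\<lambda>i. c * y i) = c * lin y"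
  by (simp add: lin_def algebra_simps sum_distrib_left)

lemma lin_diff: "lin (\<lambda>i. x i - y i) = lin x - lin y"
  by (simp add: lin_def algebra_simps sum_subtractf)


lemmas lin_linear = lin_add lin_scale lin_diff

definition axis :: "nat \<Rightarrow> nat \<Rightarrow> complex" where
  "axis j = (\<lambda>i. if i = j then 1 else 0)"

lemma bil_axis_left: "j \<le> Suc k \<Longrightarrow> bil (axis j) y = of_rat (a j) * y j"
  by (simp add: bil_def axis_def if_distrib[of "\<lambda>x. x * _"] if_distrib[of "\<lambda>x. _ * x"] sum.delta cong: if_cong)

lemma lin_axis: "j \<le> Suc k \<Longrightarrow> lin (axis j) = of_rat (a j)"
  by (simp add: lin_def axis_def if_distrib[of "\<lambda>x. _ * x"] sum.delta cong: if_cong)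

text \<open>The combination \<open>s e + t u\<close>, cut off beyond index \<open>k + 1\<close> as
  coordinate vectors require. Both maps below take values of this shape.\<close>

definition shift :: "complex \<Rightarrow> complex \<Rightarrow> (nat \<Rightarrow> complex) \<Rightarrow> nat \<Rightarrow> complex" where
  "shift s t u = (\<lambda>j. if j \<le> Suc k then s + t * u j else 0)"

lemma lin_shift: "lin (shift s t u) = t * lin u"
proof -
  have "lin (shift s t u) = (\<Sum>j\<le>Suc k. s * of_rat (a j) + t * (of_rat (a j) * u j))"
    unfolding lin_def shift_def by (rule sum.cong) (auto simp: algebra_simps)
  also have "\<dots> = s * (\<Sum>j\<le>Suc k. of_rat (a j)) + t * lin u"
    unfolding lin_def sum.distrib sum_distrib_left ..
  finally show ?thesis by (simp only: of_rat_a_sum) simp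
qed

text \<open>The \<open>s ^ 2\<close> term drops out because \<open>e\<close> is isotropic, and the
  cross term is the polar form at \<open>e\<close>.\<close>

lemma bil_shift: "bil (shift s t u) (shift s t u) = 2 * s * t * lin u + t ^ 2 * bil u u"
proof -
  have "bil (shift s t u) (shift s t u) = (\<Sum>j\<le>Suc k. s ^ 2 * of_rat (a j) +
      2 * s * t * (of_rat (a j) * u j) + t ^ 2 * (of_rat (a j) * u j * u j))"
    unfolding bil_def shift_def by (rule sum.cong) (auto simp: algebra_simps power2_eq_square)
  also have "\<dots> = s ^ 2 * (\<Sum>j\<le>Suc k. of_rat (a j)) + 2 * s * t * lin u + t ^ 2 * bil u u"
    unfolding bil_def lin_def sum.distrib sum_distrib_left ..
  finally show ?thesis by (simp only: of_rat_a_sum) simp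
qed

section \<open>Points of the quadric\<close>

lemma peval_quadric_poly: "peval quadric_poly y = bil y y"
proof -
  have "peval quadric_poly y = (\<Sum>j\<le>Suc k. of_rat (a j) * y j ^ 2)"
    by (simp only: quadric_poly_def peval_sum peval_mult peval_Cnst peval_Y_square)
  then show ?thesis by (simp only: bil_def power2_eq_square mult.assoc)
qed

lemma quadric_poly_forms: "quadric_poly \<in> forms (Suc k) 2"
  unfolding quadric_poly_def by (intro forms_sum forms_Cnst_mult forms_Y_square) auto

lemma hclass_mem_quadric: "hclass y \<in> quadric \<longleftrightarrow> hclass y \<in> proj_space (Suc k) \<and> bil y y = 0"
proof -
  have "{quadric_poly} \<subseteq> (\<Union>d. forms (Suc k) d)" using quadric_poly_forms by blast
  then show ?thesis by (simp add: quadric_def hclass_mem_zero_locus peval_quadric_poly)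
qed

lemma quadric_cases:
  assumes "P \<in> quadric"
  obtains y where "P = hclass y" "hclass y \<in> quadric"
proof -
  have "P \<in> proj_space (Suc k)"
    using assms by (simp add: quadric_def zero_locus_def)
  then obtain y where "P = hclass y" by (rule proj_space_cases)
  then show thesis using assms that by simp
qed

section \<open>The projection, the parametrization and their composites\<close>

lemma tuple_eval_proj:
  assumes "\<forall>i>Suc k. y i = 0"
  shows "tuple_eval k proj y = shift (- y (Suc k)) 1 y"
proof
  show "tuple_eval k proj y j = shift (- y (Suc k)) 1 y j" for j
    by (cases "j = Suc k") (simp_all add: tuple_eval_def proj_def peval_diff shift_def le_Suc_eq)
qed

lemma tuple_eval_param:
  assumes "\<forall>i>k. u i = 0"
  shows "tuple_eval (Suc k) param u = shift (bil u u) (- 2 * lin u) u"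
proof
  fix j
  \<comment> \<open>A zero last coordinate lets the sums up to \<open>k\<close> in
    \<open>param\<close> stand for the full forms, and accounts for the missing second term at index
    \<open>k + 1\<close>.\<close>
  have u: "u (Suc k) = 0" using assms by simp
  have "bil u u = (\<Sum>i\<le>k. of_rat (a i) * u i ^ 2)" "lin u = (\<Sum>i\<le>k. of_rat (a i) * u i)"
    by (simp_all add: bil_def lin_def u power2_eq_square mult.assoc)
  then have "peval (param j) u = bil u u - (if j \<le> k then 2 * lin u * u j else 0)"
    by (simp add: param_def peval_diff peval_mult peval_sum)
  then show "tuple_eval (Suc k) param u j = shift (bil u u) (- 2 * lin u) u j"
    by (cases "j = Suc k") (simp_all add: tuple_eval_def shift_def u le_Suc_eq)
qed

lemma param_proj:
  assumes "\<forall>i>Suc k. y i = 0" "bil y y = 0"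
  shows "tuple_eval (Suc k) param (tuple_eval k proj y) = (\<lambda>i. (- 2 * lin y) * y i)"
proof -
  let ?u = "tuple_eval k proj y"
  note u = tuple_eval_proj[OF assms(1)]
  have "tuple_eval (Suc k) param ?u = shift (bil ?u ?u) (- 2 * lin ?u) ?u"
    by (rule tuple_eval_param) (simp add: tuple_eval_def)
  \<comment> \<open>As \<open>y\<close> is isotropic, only the cross term of
    \<open>bil_shift\<close> remains. The multiples of \<open>e\<close> then cancel, leaving a
    multiple of \<open>y\<close>.\<close>
  also have "\<dots> = shift (- 2 * y (Suc k) * lin y) (- 2 * lin y) ?u"
    by (simp add: u bil_shift lin_shift assms(2))
  also have "\<dots> = (\<lambda>i. (- 2 * lin y) * y i)"
    using assms(1) by (intro ext) (simp add: u shift_def algebra_simps)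
  finally show ?thesis .
qed

text \<open>Projection discards the multiple of \<open>e\<close> in the parametrization and keeps
  the multiple of \<open>u\<close>, whose last coordinate is already 0.\<close>

lemma proj_param:
  assumes "\<forall>i>k. u i = 0"
  shows "tuple_eval k proj (tuple_eval (Suc k) param u) = (\<lambda>i. (- 2 * lin u) * u i)"
proof -
  let ?y = "tuple_eval (Suc k) param u"
  have "tuple_eval k proj ?y = shift (- ?y (Suc k)) 1 ?y"
    by (rule tuple_eval_proj) (simp add: tuple_eval_def)
  also have "\<dots> = (\<lambda>i. (- 2 * lin u) * u i)"
    using assms by (intro ext) (simp add: tuple_eval_param[OF assms] shift_def)
  finally show ?thesis .
qed

text \<open>With \<open>s = bil u u\<close> and \<open>t = - 2 * lin u\<close> the two terms of
  \<open>bil_shift\<close> cancel.\<close>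

lemma param_mem_quadric:
  assumes "\<forall>i>k. u i = 0" "tuple_eval (Suc k) param u \<noteq> (\<lambda>_. 0)"
  shows "hclass (tuple_eval (Suc k) param u) \<in> quadric"
proof -
  have "\<forall>i>Suc k. tuple_eval (Suc k) param u i = 0"
    by (simp add: tuple_eval_def)
  moreover have "bil (tuple_eval (Suc k) param u) (tuple_eval (Suc k) param u) = 0"
    by (simp add: tuple_eval_param[OF assms(1)] bil_shift power2_eq_square)
  ultimately show ?thesis
    using assms(2) by (simp add: hclass_mem_quadric hclass_mem_proj_space)
qed

text \<open>The projection of \<open>y\<close> is a preimage: parametrizing it returns
  \<open>y\<close> scaled by \<open>- 2 * lin y\<close>, which is nonzero.\<close>

lemma mem_rat_image_param:
  assumes "hclass y \<in> quadric" "lin y \<noteq> 0"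
  shows "hclass y \<in> rat_image (proj_space k) (Suc k) param"
proof -
  let ?u = "tuple_eval k proj y"
  have y: "\<forall>i>Suc k. y i = 0" "bil y y = 0" "y \<noteq> (\<lambda>_. 0)"
    using assms(1) by (auto simp: hclass_mem_quadric hclass_mem_proj_space)
  have "lin ?u = lin y" by (simp add: tuple_eval_proj[OF y(1)] lin_shift)
  then have "?u \<noteq> (\<lambda>_. 0)" using assms(2) by (metis lin_zero)
  then have "hclass ?u \<in> proj_space k"
    by (simp add: hclass_mem_proj_space) (simp add: tuple_eval_def)
  moreover have "hclass (tuple_eval (Suc k) param ?u) = hclass y"
    unfolding param_proj[OF y(1,2)] by (rule hclass_scale) (use assms(2) in simp)
  moreover have "tuple_eval (Suc k) param ?u \<noteq> (\<lambda>_. 0)"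
    using y(3) assms(2) by (auto simp: param_proj[OF y(1,2)] fun_eq_iff)
  ultimately show ?thesis unfolding rat_image_def by blast
qed

lemma mem_rat_image_proj:
  assumes "hclass u \<in> proj_space k" "lin u \<noteq> 0"
  shows "hclass u \<in> rat_image quadric k proj"
proof -
  let ?y = "tuple_eval (Suc k) param u"
  have u: "\<forall>i>k. u i = 0" "u \<noteq> (\<lambda>_. 0)"
    using assms(1) by (auto simp: hclass_mem_proj_space)
  have "tuple_eval k proj ?y \<noteq> (\<lambda>_. 0)"
    using u(2) assms(2) by (auto simp: proj_param[OF u(1)] fun_eq_iff)
  \<comment> \<open>The projection sends the zero vector to zero, so a nonzero composite forces a
    nonzero intermediate vector.\<close>
  moreover from this have "?y \<noteq> (\<lambda>_. 0)"
    using tuple_eval_proj[of "\<lambda>_. 0"] by (auto simp: shift_def)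
  then have "hclass ?y \<in> quadric" by (rule param_mem_quadric[OF u(1)])
  moreover have "hclass (tuple_eval k proj ?y) = hclass u"
    unfolding proj_param[OF u(1)] by (rule hclass_scale) (use assms(2) in simp)
  ultimately show ?thesis unfolding rat_image_def mem_Collect_eq by (intro exI[of _ ?y]) simp
qed

section \<open>Both maps as rational maps\<close>

lemma proj_forms: "j \<le> k \<Longrightarrow> proj j \<in> forms (Suc k) 1"
  unfolding proj_def by (intro forms_diff forms_Y) auto

lemma param_forms: "param j \<in> forms k 2"
proof -
  have "Cnst 2 * ((\<Sum>i\<le>k. Cnst (a i) * Y i) * Y j) \<in> forms k (1 + 1)" if "j \<le> k"
    using that by (intro forms_Cnst_mult forms_mult forms_sum forms_Y) auto
  then show ?thesis
    unfolding param_def by (intro forms_diff forms_sum forms_Cnst_mult forms_Y_square) (auto simp: forms_zero numeral_2_eq_2)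
qed

lemma hclass_axis: "j \<le> k \<Longrightarrow> hclass (axis j) \<in> proj_space k"
  by (auto simp: hclass_mem_proj_space axis_def fun_eq_iff)

lemma rational_map_proj: "rational_map (Suc k) quadric k (proj_space k) proj"
proof -
  have "hclass (axis 0) \<in> rat_image quadric k proj"
    by (rule mem_rat_image_proj) (auto simp: hclass_axis lin_axis a_neq_0)
  moreover have "rat_image quadric k proj \<subseteq> proj_space k"
    by (auto simp: rat_image_def hclass_mem_proj_space tuple_eval_def)
  ultimately show ?thesis
    unfolding rational_map_def using proj_forms by blast
qed

lemma rational_map_param: "rational_map k (proj_space k) (Suc k) quadric param"
proof -
  let ?u = "axis 0"
  have "hclass ?u \<in> proj_space k" by (simp add: hclass_axis)
  \<comment> \<open>This coordinate equals \<open>a 0 - 2 * a 0 = - a 0\<close>.\<close>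
  moreover have "tuple_eval (Suc k) param ?u 0 \<noteq> 0"
    by (subst tuple_eval_param)
      (auto simp: shift_def bil_axis_left lin_axis a_neq_0, auto simp: axis_def a_neq_0)
  ultimately have "rat_image (proj_space k) (Suc k) param \<noteq> {}"
    unfolding rat_image_def by fastforce
  moreover have "rat_image (proj_space k) (Suc k) param \<subseteq> quadric"
    by (auto simp: rat_image_def hclass_mem_proj_space intro: param_mem_quadric[simplified])
  ultimately show ?thesis
    unfolding rational_map_def using param_forms by blast
qed

section \<open>Dominance of both maps\<close>

lemma dominant_proj: "dominant quadric k (proj_space k) proj"
  unfolding dominant_def
proof (intro allI impI subsetI)
  fix Z P assume Z: "zariski_closed k Z" "rat_image quadric k proj \<subseteq> Z" and P: "P \<in> proj_space k"
  obtain u where u: "P = hclass u" using P by (rule proj_space_cases)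
  \<comment> \<open>Points with \<open>lin\<close> nonzero are in the image. Along this line through
    \<open>u\<close> the value of \<open>lin\<close> is \<open>lin u + t * a 0\<close>, which
    vanishes for a single \<open>t\<close>.\<close>
  have *: "(\<lambda>i. poly [:u i, axis 0 i:] t) = (\<lambda>i. u i + t * axis 0 i)" for t
    by simp
  have "hclass (\<lambda>i. poly [:u i, axis 0 i:] 0) \<in> Z"
  proof (rule zariski_closed_polynomial_curve[OF Z(1), of "{- lin u / of_rat (a 0)}"])
    fix t assume "t \<notin> {- lin u / of_rat (a 0)}"
    then have lin: "lin (\<lambda>i. u i + t * axis 0 i) \<noteq> 0"
      by (auto simp: lin_linear lin_axis a_neq_0 field_simps add_eq_0_iff)
    then have "(\<lambda>i. u i + t * axis 0 i) \<noteq> (\<lambda>_. 0)" by (metis lin_zero)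
    then have "hclass (\<lambda>i. u i + t * axis 0 i) \<in> proj_space k"
      using P by (simp add: u hclass_mem_proj_space) (simp add: axis_def)
    then have "hclass (\<lambda>i. u i + t * axis 0 i) \<in> Z"
      using mem_rat_image_proj[OF _ lin] Z(2) by blast
    then show "hclass (\<lambda>i. poly [:u i, axis 0 i:] t) \<in> Z" unfolding * .
  qed (use P u in auto)
  then show "P \<in> Z" by (simp add: u)
qed

text \<open>If some \<open>y i\<close> is 0, the axis vector \<open>axis i\<close> works. Otherwise
  combine two axes orthogonally to \<open>y\<close>; the value of the form is then
  \<open>a i * a j * (w i + w j)\<close>. If all sums \<open>w i + w j\<close> with distinct indices
  vanished, the three indices 0, 1, 2 would force \<open>w 0 = 0\<close>.\<close>

lemma exists_anisotropic_orthogonal: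
  obtains v where "bil v y = 0" "bil v v \<noteq> 0" "\<forall>i>Suc k. v i = 0"
proof (cases "\<forall>i\<le>Suc k. y i \<noteq> 0")
  case False
  then obtain i where "i \<le> Suc k" "y i = 0" by auto
  then show ?thesis
    by (intro that[of "axis i"]) (auto simp: bil_axis_left of_rat_a_neq_0, auto simp: axis_def a_neq_0)
next
  case True
  define w where "w i = complex_of_rat (a i) * y i ^ 2" for i
  obtain i j where ij: "i \<le> Suc k" "j \<le> Suc k" "i \<noteq> j" "w i + w j \<noteq> 0"
  proof (rule ccontr)
    assume "\<not> thesis"
    then have *: "\<And>i j. i \<le> Suc k \<Longrightarrow> j \<le> Suc k \<Longrightarrow> i \<noteq> j \<Longrightarrow> w i + w j = 0" using that by blast
    have "w 0 + w 1 = 0" "w 0 + w 2 = 0" "w 1 + w 2 = 0" using k by (auto intro!: *)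
    moreover have "2 * w 0 = (w 0 + w 1) + (w 0 + w 2) - (w 1 + w 2)" by simp
    ultimately have "w 0 = 0" by simp
    then show False using True by (auto simp: w_def a_neq_0)
  qed
  let ?v = "\<lambda>l. (of_rat (a i) * y i) * axis j l - (of_rat (a j) * y j) * axis i l"
  show ?thesis
  proof
    show "bil ?v y = 0" using ij by (simp add: bil_linear bil_axis_left)
    have "bil ?v ?v = of_rat (a i) * of_rat (a j) * (w i + w j)"
      using ij by (simp add: bil_linear bil_axis_left)
        (simp add: axis_def w_def algebra_simps power2_eq_square)
    then show "bil ?v ?v \<noteq> 0" using ij by (simp add: a_neq_0)
    show "\<forall>l>Suc k. ?v l = 0" using ij by (auto simp: axis_def)
  qed
qed

text \<open>A point \<open>y\<close> of the tangent hyperplane \<open>lin y = 0\<close> is not in the image of \<open>param\<close> in general.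
  Reflecting \<open>y\<close> in a vector that moves away from an anisotropic vector orthogonal to \<open>y\<close> yields a
  curve on the quadric that passes through \<open>y\<close> and leaves that hyperplane.\<close>

lemma dominant_param: "dominant (proj_space k) (Suc k) quadric param"
  unfolding dominant_def
proof (intro allI impI subsetI)
  fix Z P assume Z: "zariski_closed (Suc k) Z" "rat_image (proj_space k) (Suc k) param \<subseteq> Z"
    and P: "P \<in> quadric"
  obtain y where P_eq: "P = hclass y" and y_mem: "hclass y \<in> quadric" using P by (rule quadric_cases)
  have y: "\<forall>i>Suc k. y i = 0" "y \<noteq> (\<lambda>_. 0)" "bil y y = 0"
    using y_mem by (auto simp: hclass_mem_quadric hclass_mem_proj_space)
  show "P \<in> Z"
  proof (cases "lin y = 0")
    case False
    then show ?thesis using mem_rat_image_param[OF y_mem] Z(2) P_eq by blast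
  next
    case True
    obtain v where v: "bil v y = 0" "bil v v \<noteq> 0" "\<forall>i>Suc k. v i = 0"
      by (rule exists_anisotropic_orthogonal)
    \<comment> \<open>A nonzero coordinate \<open>y l\<close> makes \<open>axis l\<close> a
      direction not orthogonal to \<open>y\<close>, with \<open>lin\<close> equal to
      \<open>a l\<close>.\<close>
    obtain l where l: "l \<le> Suc k" "y l \<noteq> 0" using y(1,2) by (metis not_less ext)
    define w where "w = axis l"
    have w: "bil w y \<noteq> 0" "lin w \<noteq> 0" "\<forall>i>Suc k. w i = 0"
      using l by (auto simp: w_def bil_axis_left lin_axis a_neq_0, auto simp: axis_def)
    define r where "r t = (\<lambda>i. v i + t * w i)" for t
    \<comment> \<open>The reflection of \<open>y\<close> in \<open>r t\<close> times
      \<open>bil (r t) (r t)\<close>: clearing the denominator makes it polynomial in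
      \<open>t\<close>. At \<open>t = 0\<close> it is a nonzero multiple of \<open>y\<close>, since
      \<open>v\<close> is orthogonal to \<open>y\<close> and anisotropic.\<close>
    define R where "R t = (\<lambda>i. bil (r t) (r t) * y i - 2 * bil (r t) y * r t i)" for t
    define c where "c i = [:bil v v, 2 * bil v w, bil w w:] * [:y i:]
      - [:0, 2 * bil w y:] * [:v i, w i:]" for i
    have bil_r: "bil (r t) (r t) = bil v v + 2 * t * bil v w + t ^ 2 * bil w w" for t
      using bil_commute[of w v]
      by (simp add: r_def bil_linear algebra_simps power2_eq_square)
    have bil_r_y: "bil (r t) y = t * bil w y" for t by (simp add: r_def bil_linear v)
    have c: "(\<lambda>i. poly (c i) t) = R t" for t
      unfolding R_def bil_r bil_r_y
      by (simp add: c_def r_def fun_eq_iff algebra_simps power2_eq_square)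
    have R0: "R 0 = (\<lambda>i. bil v v * y i)" by (simp add: R_def r_def v)
    have bil_R: "bil (R t) (R t) = 0" for t
      using bil_commute[of y "r t"] by (simp add: R_def bil_linear y)
    \<comment> \<open>Since \<open>lin y = 0\<close>, only the term along \<open>r t\<close>
      contributes. The two roots in \<open>t\<close> are the parameters excluded below.\<close>
    have lin_R: "lin (R t) = - 2 * t * bil w y * (lin v + t * lin w)" for t
      unfolding R_def lin_linear True bil_r_y by (simp add: r_def lin_linear algebra_simps)
    have "hclass (\<lambda>i. poly (c i) 0) \<in> Z"
    proof (rule zariski_closed_polynomial_curve[OF Z(1), of "{0, - lin v / lin w}"])
      fix t assume "t \<notin> {0, - lin v / lin w}"
      then have "t \<noteq> 0" "lin v + t * lin w \<noteq> 0"
        using w(2) by (auto simp: field_simps add_eq_0_iff)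
      then have lin: "lin (R t) \<noteq> 0"
        using w(1) by (simp add: lin_R)
      then have "R t \<noteq> (\<lambda>_. 0)" by (metis lin_zero)
      moreover have "\<forall>i>Suc k. R t i = 0" using y v w by (simp add: R_def r_def)
      ultimately have "hclass (R t) \<in> quadric"
        by (simp add: hclass_mem_quadric hclass_mem_proj_space bil_R)
      then show "hclass (\<lambda>i. poly (c i) t) \<in> Z"
        unfolding c using mem_rat_image_param[OF _ lin] Z(2) by blast
    next
      show "hclass (\<lambda>i. poly (c i) 0) \<in> proj_space (Suc k)"
        using y_mem v(2) unfolding c R0 by (simp add: hclass_scale hclass_mem_quadric)
    qed simp
    then show ?thesis using v(2) unfolding c R0 by (simp add: hclass_scale P_eq)
  qed
qed

section \<open>Birationality\<close>

lemma Q_birational_quadric: "Q_birational (Suc k) quadric k (proj_space k)"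
proof -
  have "comp_is_id quadric (Suc k) k proj param"
    unfolding comp_is_id_def
  proof (intro allI impI)
    fix y assume "hclass y \<in> quadric"
      and *: "tuple_eval (Suc k) param (tuple_eval k proj y) \<noteq> (\<lambda>_. 0)"
    then have "\<forall>i>Suc k. y i = 0" "bil y y = 0"
      by (auto simp: hclass_mem_quadric hclass_mem_proj_space)
    note eq = param_proj[OF this]
    \<comment> \<open>The composite is \<open>y\<close> scaled by \<open>- 2 * lin y\<close>, so
      where it is nonzero the scalar is nonzero.\<close>
    have "lin y \<noteq> 0" using * unfolding eq by auto
    then show "hclass (tuple_eval (Suc k) param (tuple_eval k proj y)) = hclass y"
      unfolding eq by (intro hclass_scale) simp
  qed
  moreover have "comp_is_id (proj_space k) k (Suc k) param proj"
    unfolding comp_is_id_def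
  proof (intro allI impI)
    fix u assume "hclass u \<in> proj_space k"
      and *: "tuple_eval k proj (tuple_eval (Suc k) param u) \<noteq> (\<lambda>_. 0)"
    then have "\<forall>i>k. u i = 0" by (auto simp: hclass_mem_proj_space)
    note eq = proj_param[OF this]
    have "lin u \<noteq> 0" using * unfolding eq by auto
    then show "hclass (tuple_eval k proj (tuple_eval (Suc k) param u)) = hclass u"
      unfolding eq by (intro hclass_scale) simp
  qed
  ultimately show ?thesis
    unfolding Q_birational_def
    using rational_map_proj dominant_proj rational_map_param dominant_param by blast
qed

section \<open>Irreducibility\<close>

lemma param_notin_closed:
  assumes "zariski_closed (Suc k) Z" "\<not> quadric \<subseteq> Z"
  obtains u where "\<forall>i>k. u i = 0" "tuple_eval (Suc k) param u \<noteq> (\<lambda>_. 0)"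
    "hclass (tuple_eval (Suc k) param u) \<notin> Z"
proof -
  have "\<not> rat_image (proj_space k) (Suc k) param \<subseteq> Z"
    using dominant_param assms by (auto simp: dominant_def)
  then show ?thesis
    using that by (auto simp: rat_image_def hclass_mem_proj_space)
qed

text \<open>A line joins a parameter point mapped outside \<open>A\<close> to one mapped outside
  \<open>B\<close>. Its image is a polynomial curve on the quadric meeting each of \<open>A\<close>
  and \<open>B\<close> for only finitely many \<open>t\<close>, so some point of it avoids
  both.\<close>

lemma quadric_irreducible:
  assumes A: "zariski_closed (Suc k) A" and B: "zariski_closed (Suc k) B" and sub: "quadric \<subseteq> A \<union> B"
  shows "quadric \<subseteq> A \<or> quadric \<subseteq> B"
proof (rule ccontr)
  let ?g = "tuple_eval (Suc k) param"
  assume "\<not> ?thesis"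
  then have not_sub: "\<not> quadric \<subseteq> A" "\<not> quadric \<subseteq> B" by simp_all
  obtain u where u: "\<forall>i>k. u i = 0" "?g u \<noteq> (\<lambda>_. 0)" "hclass (?g u) \<notin> A"
    by (rule param_notin_closed[OF A not_sub(1)])
  obtain v where v: "\<forall>i>k. v i = 0" "?g v \<noteq> (\<lambda>_. 0)" "hclass (?g v) \<notin> B"
    by (rule param_notin_closed[OF B not_sub(2)])
  define r where "r t = (\<lambda>i. u i + t * (v i - u i))" for t
  have r: "\<forall>i>k. r t i = 0" for t using u(1) v(1) by (simp add: r_def)
  have r_poly: "r t = (\<lambda>i. poly [:u i, v i - u i:] t)" for t by (simp add: r_def)
  have "\<exists>P. \<forall>t. ?g (r t) i = poly P t" for i
  proof -
    obtain P where "\<forall>t. peval (param i) (\<lambda>i. poly [:u i, v i - u i:] t) = poly P t"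
      using peval_polynomial_curve[of "param i" "\<lambda>i. [:u i, v i - u i:]"] ..
    then show ?thesis
      by (intro exI[of _ "if i \<le> Suc k then P else 0"]) (simp only: r_poly tuple_eval_def poly_0 split: if_split, blast)
  qed
  then obtain c where c: "\<And>i t. ?g (r t) i = poly (c i) t" by metis
  have g: "?g (r t) = (\<lambda>i. poly (c i) t)" for t by (simp add: c fun_eq_iff)
  have r01: "r 0 = u" "r 1 = v" by (simp_all add: r_def)
  have proj: "hclass (?g u) \<in> proj_space (Suc k)" "hclass (?g v) \<in> proj_space (Suc k)"
    using param_mem_quadric[OF u(1,2)] param_mem_quadric[OF v(1,2)] by (simp_all only: hclass_mem_quadric)
  have "finite {t. hclass (\<lambda>i. poly (c i) t) \<in> A}"
    by (rule finite_polynomial_curve_mem[OF A, of c 0, folded g, unfolded r01, unfolded g])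
      (fact proj u)+
  moreover have "finite {t. hclass (\<lambda>i. poly (c i) t) \<in> B}"
    by (rule finite_polynomial_curve_mem[OF B, of c 1, folded g, unfolded r01, unfolded g])
      (fact proj v)+
  \<comment> \<open>Avoiding the finitely many roots of this one coordinate keeps the image vector
    nonzero, so that it represents a point.\<close>
  moreover obtain j where "?g u j \<noteq> 0" using u(2) by auto
  then have "c j \<noteq> 0" using c[of 0 j] unfolding r01 by auto
  then have "finite {t. poly (c j) t = 0}" by (rule poly_roots_finite)
  ultimately have "finite ({t. hclass (\<lambda>i. poly (c i) t) \<in> A} \<union> {t. hclass (\<lambda>i. poly (c i) t) \<in> B}
      \<union> {t. poly (c j) t = 0})" (is "finite ?E") by simp
  then obtain t where "t \<notin> ?E"
    using ex_new_if_finite[OF infinite_UNIV_char_0] by metis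
  then have t: "hclass (?g (r t)) \<notin> A" "hclass (?g (r t)) \<notin> B" "?g (r t) j \<noteq> 0"
    by (simp_all add: g)
  then have "?g (r t) \<noteq> (\<lambda>_. 0)" by auto
  then have "hclass (?g (r t)) \<in> quadric" by (rule param_mem_quadric[OF r])
  then show False using t sub by blast
qed

lemma proj_variety_quadric: "proj_variety (Suc k) quadric"
proof -
  have "rat_image (proj_space k) (Suc k) param \<noteq> {}" "rat_image (proj_space k) (Suc k) param \<subseteq> quadric"
    using rational_map_param by (auto simp: rational_map_def)
  then have "quadric \<noteq> {}" by blast
  moreover have "zariski_closed (Suc k) quadric"
    unfolding quadric_def using quadric_poly_forms by (rule zariski_closed_zero_locus)
  ultimately show ?thesis
    unfolding proj_variety_def using quadric_irreducible by blast
qed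

theorem rational_variety_quadric: "rational_variety (Suc k) quadric"
  unfolding rational_variety_def using proj_variety_quadric Q_birational_quadric k by blast

end


section \<open>The coefficients of the Vandermonde quadric\<close>

text \<open>A kernel vector of the transpose lists the coefficients of a polynomial of degree below
  \<open>n\<close> that vanishes at \<open>n\<close> distinct nodes.\<close>

lemma det_vandermonde_neq_0:
  fixes z :: "nat \<Rightarrow> 'a :: field"
  assumes "inj_on z {..<n}"
  shows "det (mat n n (\<lambda>(i, j). z j ^ i)) \<noteq> 0"
proof
  let ?V = "mat n n (\<lambda>(i, j). z j ^ i)"
  assume "det ?V = 0"
  then have "det (transpose_mat ?V) = 0" by (simp add: det_transpose[of _ n])
  then obtain v where v: "v \<in> carrier_vec n" "v \<noteq> 0\<^sub>v n" "transpose_mat ?V *\<^sub>v v = 0\<^sub>v n"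
    using det_0_iff_vec_prod_zero[of "transpose_mat ?V" n] by auto
  define p where "p = (\<Sum>i<n. monom (v $ i) i)"
  have coeff: "coeff p i = v $ i" if "i < n" for i
    using that by (simp add: p_def coeff_sum sum.delta)
  have "poly p (z j) = 0" if j: "j < n" for j
  proof -
    have "poly p (z j) = (transpose_mat ?V *\<^sub>v v) $ j"
      using j v(1) by (simp add: p_def poly_sum poly_monom scalar_prod_def atLeast0LessThan mult.commute)
    then show ?thesis using j v(3) by simp
  qed
  then have roots: "z ` {..<n} \<subseteq> {x. poly p x = 0}" by auto
  have "p = 0"
  proof (rule ccontr)
    assume "p \<noteq> 0"
    have "n = card (z ` {..<n})" using assms by (simp add: card_image)
    also have "\<dots> \<le> card {x. poly p x = 0}"
      by (rule card_mono) (use roots poly_roots_finite[OF \<open>p \<noteq> 0\<close>] in auto)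
    also have "\<dots> \<le> degree p" by (rule card_poly_roots_bound[OF \<open>p \<noteq> 0\<close>])
    finally have "n \<le> degree p" .
    then have "coeff p (degree p) = 0" by (simp add: p_def coeff_sum)
    then show False using \<open>p \<noteq> 0\<close> by simp
  qed
  then have "v = 0\<^sub>v n" using v(1) coeff by (intro eq_vecI) auto
  then show False using v(2) by blast
qed

section \<open>Expansion along the last row\<close>

definition vandermonde_row :: "nat \<Rightarrow> (nat \<Rightarrow> rat) \<Rightarrow> (nat \<Rightarrow> rat) \<Rightarrow> rat mat" where
  "vandermonde_row k x z = mat (k + 2) (k + 2) (\<lambda>(i, j). if i \<le> k then x j ^ i else z j)"

definition W_coeff :: "nat \<Rightarrow> (nat \<Rightarrow> rat) \<Rightarrow> nat \<Rightarrow> rat" where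
  "W_coeff k x j = cofactor (vandermonde_row k x (\<lambda>_. 0)) (Suc k) j"

text \<open>The cofactor deletes the last row, so it is the same for every \<open>z\<close>.\<close>

lemma cofactor_vandermonde_row: "j \<le> Suc k \<Longrightarrow> cofactor (vandermonde_row k x z) (Suc k) j = W_coeff k x j"
  unfolding W_coeff_def cofactor_def
  by (rule arg_cong[where f = "\<lambda>M. _ * det M"])
    (auto simp: mat_delete_def vandermonde_row_def)

lemma det_vandermonde_row: "det (vandermonde_row k x z) = (\<Sum>j\<le>Suc k. z j * W_coeff k x j)"
proof -
  have "det (vandermonde_row k x z) =
      (\<Sum>j<k + 2. vandermonde_row k x z $$ (Suc k, j) * cofactor (vandermonde_row k x z) (Suc k) j)"
    by (rule laplace_expansion_row) (auto simp: vandermonde_row_def)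
  also have "\<dots> = (\<Sum>j<k + 2. z j * W_coeff k x j)"
    by (rule sum.cong) (auto simp: cofactor_vandermonde_row, simp add: vandermonde_row_def)
  finally show ?thesis by (simp add: lessThan_Suc_atMost)
qed

lemma W_coeff_sum: "(\<Sum>j\<le>Suc k. W_coeff k x j) = 0"
proof -
  \<comment> \<open>Row 0 holds the powers \<open>x j ^ 0 = 1\<close> and so equals the last
    row.\<close>
  have "det (vandermonde_row k x (\<lambda>_. 1)) = 0"
    by (rule det_identical_rows[of _ "k + 2" 0 "Suc k"]) (auto simp: vandermonde_row_def)
  then show ?thesis by (simp add: det_vandermonde_row)
qed

lemma W_coeff_neq_0:
  assumes "inj_on x {..Suc k}" "j \<le> Suc k"
  shows "W_coeff k x j \<noteq> 0"
proof -
  \<comment> \<open>Enumerates the columns other than \<open>j\<close>, so the minor is the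
    Vandermonde matrix of the remaining \<open>k + 1\<close> nodes.\<close>
  let ?skip = "\<lambda>l. if l < j then l else Suc l"
  define z where "z = x \<circ> ?skip"
  have "inj_on z {..<Suc k}"
    unfolding z_def
    by (rule comp_inj_on, rule inj_onI) (auto split: if_splits intro: inj_on_subset[OF assms(1)])
  moreover have "mat_delete (vandermonde_row k x (\<lambda>_. 0)) (Suc k) j = mat (Suc k) (Suc k) (\<lambda>(i, j). z j ^ i)"
    by (auto simp: mat_delete_def vandermonde_row_def z_def)
  ultimately show ?thesis
    unfolding W_coeff_def cofactor_def using det_vandermonde_neq_0[of z "Suc k"] by simp
qed

text \<open>All rows but the last are constant, so the cofactors along the last row are images of
  rational ones under the ring homomorphism \<open>Cnst\<close>.\<close>

lemma W_poly_eq: "W_poly k x = (\<Sum>j\<le>Suc k. Cnst (W_coeff k x j) * Y j ^ 2)"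
proof -
  interpret Cnst: comm_ring_hom Cnst by (rule comm_ring_hom_Cnst)
  let ?M = "mat (k + 2) (k + 2) (\<lambda>(i, j). if i \<le> k then Cnst (x j ^ i) else Y j ^ 2)"
  have "cofactor ?M (Suc k) j = Cnst (W_coeff k x j)" if "j \<le> Suc k" for j
  proof -
    have "mat_delete ?M (Suc k) j = map_mat Cnst (mat_delete (vandermonde_row k x (\<lambda>_. 0)) (Suc k) j)"
      using that by (auto simp: mat_delete_def vandermonde_row_def)
    then show ?thesis
      by (simp add: W_coeff_def cofactor_def Cnst.hom_mult Cnst.hom_power Cnst.hom_uminus)
  qed
  moreover have "det ?M = (\<Sum>j<k + 2. ?M $$ (Suc k, j) * cofactor ?M (Suc k) j)"
    by (rule laplace_expansion_row) auto
  ultimately show ?thesis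
    unfolding W_poly_def by (simp add: lessThan_Suc_atMost mult.commute)
qed

theorem theorem4p1:
  fixes k :: nat and x :: "nat \<Rightarrow> rat"
  assumes "k \<ge> 1" and "inj_on x {..k + 1}"
  shows "rational_variety (k + 1) (W_quadric k x)"
proof -
  interpret diagonal_quadric k "W_coeff k x"
    by unfold_locales (use assms W_coeff_sum W_coeff_neq_0 in auto)
  have "W_quadric k x = quadric"
    by (simp add: W_quadric_def quadric_def quadric_poly_def W_poly_eq)
  then show ?thesis using rational_variety_quadric by simp
qed

end
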